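(* Let $f(\boldsymbol{w})=f_\ell(\boldsymbol{A}\boldsymbol{w})+\phi_\lambda(\boldsymbol{w})$ be the objective function on $\mathbb{R}^n$ described in the context. Let $\boldsymbol{w}^1,\boldsymbol{w}^2,\ldots$ be the sequence generated by the DAL algorithm and let $W^\ast$ be the set of minimizers of $f$. Assume that there are a positive constant $\sigma$ and a scalar $\alpha$ ($1\le\alpha\le2$) such that (A1) $\quad f(\boldsymbol{w}^{t+1})-f(W^\ast)\ge\sigma\|\boldsymbol{w}^{t+1}-W^\ast\|^\alpha\qquad(t=0,1,2,\ldots),$ where $f(W^\ast)$ denotes the minimum objective value, and $\|\boldsymbol{w}-W^\ast\|:=\min_{\boldsymbol{w}^\ast\in W^\ast}\|\boldsymbol{w}-\boldsymbol{w}^\ast\|$ denotes the minimum distance between $\boldsymbol{w}\in\mathbb{R}^n$ and $W^\ast$. If the inner minimization is solved exactly (i.e. $\boldsymbol{\alpha}^t$ is an exact minimizer of $\varphi_t$ at every step $t$), then $$\|\boldsymbol{w}^{t+1}-W^\ast\|+\sigma\eta_t\|\boldsymbol{w}^{t+1}-W^\ast\|^{\alpha-1}\le\|\boldsymbol{w}^t-W^\ast\|.$$ Moreover, this implies that $$\|\boldsymbol{w}^{t+1}-W^\ast\|^{\frac{1+(\alpha-1)\sigma\eta_t}{1+\sigma\eta_t}}\le\frac{1}{1+\sigma\eta_t}\|\boldsymbol{w}^t-W^\ast\|.$$ That is, $\boldsymbol{w}^t$ converges to $W^\ast$ super-linearly if $\alpha<2$, or if $\alpha=2$ and $\eta_t$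 is increasing, in a global and non-asymptotic sense.
   Context: Norms are Euclidean. Problem: minimize $f(\boldsymbol{w})=f_\ell(\boldsymbol{A}\boldsymbol{w})+\phi_\lambda(\boldsymbol{w})$ over $\boldsymbol{w}\in\mathbb{R}^n$, where $\boldsymbol{A}\in\mathbb{R}^{m\times n}$ and $\lambda>0$ is a regularization constant. Standing assumptions. The loss $f_\ell:\mathbb{R}^m\to\mathbb{R}\cup\{+\infty\}$ is a closed proper strictly convex function with Lipschitz continuous gradient of modulus $1/\gamma$: $\|\nabla f_\ell(\boldsymbol{z})-\nabla f_\ell(\boldsymbol{z}')\|\le\frac1\gamma\|\boldsymbol{z}-\boldsymbol{z}'\|$ for all $\boldsymbol{z},\boldsymbol{z}'\in\mathbb{R}^m$. Its convex conjugate $f_\ell^\ast(\boldsymbol{y})=\sup_{\boldsymbol{x}}(\boldsymbol{y}^\top\boldsymbol{x}-f_\ell(\boldsymbol{x}))$ is (essentially) twice differentiable. The regularizer $\phi_\lambda$ is a closed proper convex, possibly non-differentiable function on $\mathbb{R}^n$, and $\phi_{\eta\lambda}=\eta\phi_\lambda$ for all $\eta>0$. The set $W^\ast$ of minimizers of $f$ is nonempty. Proximity operator: $\mathrm{prox}_{g}(\boldsymbol{y})=\arg\min_{\boldsymbol{x}\in\mathbb{R}^n}\left(\frac12\|\boldsymbol{y}-\boldsymbol{x}\|^2+g(\boldsymbol{x})\right)$. Moreau envelope of the conjugate $\phi_{\lambda}^\ast$ of $\phi_\lambda$: $\Phi_{\lambda}^\ast(\boldsymbol{w})=\min_{\boldsymbol{x}\in\mathbb{R}^n}\left(\phi_{\lambda}^\ast(\boldsymbol{x})+\frac12\|\boldsymbol{x}-\boldsymbol{w}\|^2\right)$.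 DAL (dual augmented Lagrangian) algorithm. Given an initial solution $\boldsymbol{w}^0\in\mathbb{R}^n$ and a non-decreasing sequence of positive proximity parameters $\eta_0\le\eta_1\le\cdots$, at each step $t=0,1,2,\ldots$ let $\boldsymbol{\alpha}^t\in\mathbb{R}^m$ be a minimizer of $$\varphi_t(\boldsymbol{\alpha})=f_\ell^\ast(-\boldsymbol{\alpha})+\frac{1}{\eta_t}\Phi_{\lambda\eta_t}^\ast(\boldsymbol{w}^t+\eta_t\boldsymbol{A}^\top\boldsymbol{\alpha})$$ (the inner minimization), and set $\boldsymbol{w}^{t+1}=\mathrm{prox}_{\phi_{\lambda\eta_t}}(\boldsymbol{w}^t+\eta_t\boldsymbol{A}^\top\boldsymbol{\alpha}^t)$. (The vectors $\boldsymbol{\alpha}^t$ are unrelated to the scalar exponent $\alpha$.)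
   Formalization: For α=2, super-linear convergence is stated only when η_t tends to infinity (it fails for increasing bounded η_t); for strictly increasing η_t the claim is convergence to W* with strictly decreasing contraction factors 1/(1+ση_t). For α=1, 0^0 is read as 0. *)

theory Defs
  imports "HOL-Analysis.Analysis"
begin

definition epi :: "('a \<Rightarrow> ereal) \<Rightarrow> ('a \<times> real) set" where
  "epi g = {(x, r). g x \<le> ereal r}"

definition effective_domain :: "('a \<Rightarrow> ereal) \<Rightarrow> 'a set" where
  "effective_domain g = {x. g x < \<infinity>}"

definition proper_fun :: "('a \<Rightarrow> ereal) \<Rightarrow> bool" where
  "proper_fun g \<longleftrightarrow> (\<forall>x. g x \<noteq> -\<infinity>) \<and> (\<exists>x. g x \<noteq> \<infinity>)"

definition closed_fun :: "('a::topological_space \<Rightarrow> ereal) \<Rightarrow> bool" where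
  "closed_fun g \<longleftrightarrow> closed (epi g)"

definition convex_fun :: "('a::real_vector \<Rightarrow> ereal) \<Rightarrow> bool" where
  "convex_fun g \<longleftrightarrow> convex (epi g)"

definition strictly_convex_fun :: "('a::real_vector \<Rightarrow> ereal) \<Rightarrow> bool" where
  "strictly_convex_fun g \<longleftrightarrow>
     (\<forall>x\<in>effective_domain g. \<forall>y\<in>effective_domain g. \<forall>u::real. x \<noteq> y \<longrightarrow> 0 < u \<longrightarrow> u < 1 \<longrightarrow>
        g ((1 - u) *\<^sub>R x + u *\<^sub>R y) < ereal (1 - u) * g x + ereal u * g y)"

text \<open>Since \<open>real_of_ereal\<close> sends infinite values to 0, differentiability at a point has to
  include finiteness of the function near that point.\<close>

definition has_gradient :: "('a::real_inner \<Rightarrow> ereal) \<Rightarrow> 'a \<Rightarrow> 'a \<Rightarrow> bool" where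
  "has_gradient g d x \<longleftrightarrow>
     (\<forall>\<^sub>F z in nhds x. \<bar>g z\<bar> \<noteq> \<infinity>) \<and> GDERIV (\<lambda>z. real_of_ereal (g z)) x :> d"

definition lipschitz_gradient :: "real \<Rightarrow> ('a::real_inner \<Rightarrow> ereal) \<Rightarrow> bool" where
  "lipschitz_gradient L g \<longleftrightarrow>
     (\<exists>G. (\<forall>z. has_gradient g (G z) z) \<and> L-lipschitz_on UNIV G)"

text \<open>``Essentially'' refers to the interior of the effective domain. Divergence of the gradient
  at the boundary of the domain is not required; it is automatic for the conjugate of a finite
  strictly convex function.\<close>

definition essentially_twice_differentiable :: "('a::real_inner \<Rightarrow> ereal) \<Rightarrow> bool" where
  "essentially_twice_differentiable g \<longleftrightarrow>
     interior (effective_domain g) \<noteq> {} \<and>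
     (\<exists>G. \<forall>x\<in>interior (effective_domain g). has_gradient g (G x) x \<and> G differentiable (at x))"

definition conjugate :: "('a::real_inner \<Rightarrow> ereal) \<Rightarrow> 'a \<Rightarrow> ereal" where
  "conjugate g y = (SUP x. ereal (y \<bullet> x) - g x)"

definition moreau_envelope :: "('a::real_normed_vector \<Rightarrow> ereal) \<Rightarrow> 'a \<Rightarrow> ereal" where
  "moreau_envelope g w = (INF x. g x + ereal (1/2 * (norm (x - w))\<^sup>2))"

definition prox :: "('a::real_normed_vector \<Rightarrow> ereal) \<Rightarrow> 'a \<Rightarrow> 'a" where
  "prox g y = arg_min (\<lambda>x. ereal (1/2 * (norm (y - x))\<^sup>2) + g x) (\<lambda>_. True)"

definition minimizers :: "('a \<Rightarrow> ereal) \<Rightarrow> 'a set" where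
  "minimizers g = {x. is_arg_min g (\<lambda>_. True) x}"

definition objective ::
  "(real^'m \<Rightarrow> ereal) \<Rightarrow> (real \<Rightarrow> real^'n \<Rightarrow> ereal) \<Rightarrow> real \<Rightarrow> real^'n^'m \<Rightarrow> real^'n \<Rightarrow> ereal" where
  "objective fl \<phi> lam A w = fl (A *v w) + \<phi> lam w"

definition inner_objective ::
  "(real^'m \<Rightarrow> ereal) \<Rightarrow> (real \<Rightarrow> real^'n \<Rightarrow> ereal) \<Rightarrow> real \<Rightarrow> real^'n^'m \<Rightarrow> real \<Rightarrow> real^'n \<Rightarrow>
   real^'m \<Rightarrow> ereal" where
  "inner_objective fl \<phi> lam A eta w a =
     conjugate fl (- a) +
     ereal (1 / eta) * moreau_envelope (conjugate (\<phi> (lam * eta))) (w + eta *\<^sub>R (transpose A *v a))"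

text \<open>\<open>w\<close> is a sequence of iterates (with arbitrary \<open>w 0\<close>) and \<open>a\<close> the sequence of exact
  solutions of the inner minimization problems.\<close>

definition exact_dal ::
  "(real^'m \<Rightarrow> ereal) \<Rightarrow> (real \<Rightarrow> real^'n \<Rightarrow> ereal) \<Rightarrow> real \<Rightarrow> real^'n^'m \<Rightarrow> (nat \<Rightarrow> real) \<Rightarrow>
   (nat \<Rightarrow> real^'n) \<Rightarrow> (nat \<Rightarrow> real^'m) \<Rightarrow> bool" where
  "exact_dal fl \<phi> lam A \<eta> w a \<longleftrightarrow>
     (\<forall>t. a t \<in> minimizers (inner_objective fl \<phi> lam A (\<eta> t) (w t)) \<and>
          w (Suc t) = prox (\<phi> (lam * \<eta> t)) (w t + \<eta> t *\<^sub>R (transpose A *v a t)))"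

text \<open>Q-superlinear convergence to a set. The ratio of successive distances is written without
  division so that a sequence reaching the set after finitely many steps qualifies.\<close>

definition superlinearly_converges_to :: "(nat \<Rightarrow> 'a::metric_space) \<Rightarrow> 'a set \<Rightarrow> bool" where
  "superlinearly_converges_to w W \<longleftrightarrow>
     (\<lambda>t. infdist (w t) W) \<longlonglongrightarrow> 0 \<and>
     (\<forall>e>0. \<forall>\<^sub>F t in sequentially. infdist (w (Suc t)) W \<le> e * infdist (w t) W)"

text \<open>Powers of distances with real exponent are written with \<open>powr\<close>, so that \<open>0 powr 0 = 0\<close>. With
  \<open>0\<^sup>0 = 1\<close> a bound \<open>d' + c * d' powr (\<alpha> - 1) \<le> d\<close>, \<open>c > 0\<close>, would fail for \<open>\<alpha> = 1\<close> as soon as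
  both distances vanish.\<close>

end

theory Submission
  imports Defs
begin

text \<open>One exact DAL step is a proximal point step for \<open>f\<close> itself. Optimality of \<open>a t\<close> for the inner
  problem makes \<open>- a t\<close> a subgradient of the loss at \<open>A *v w (Suc t)\<close>, and adding the subgradient
  of the regularizer supplied by the proximity operator gives
  \<open>(w t - w (Suc t)) / \<eta> t \<in> \<partial>f (w (Suc t))\<close>. Comparing with the minimum through (A1) and splitting
  \<open>w t - w (Suc t)\<close> along the projections of both iterates onto \<open>W\<close> gives
  \<open>d'\<^sup>2 + \<sigma> \<eta> d' powr \<alpha> \<le> d d'\<close>. The remaining claims about the distances follow from this recursion
  and the weighted arithmetic-geometric mean inequality.\<close>

section \<open>First-order conditions for convex functions\<close>

text \<open>Divide by \<open>s\<close> and let \<open>s\<close> tend to 0 from the right. This turns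
  minimality along a segment into a first-order inequality, both for the proximity operator and for
  the inner objective.\<close>

lemma nonneg_if_quadratic_nonneg_near_0:
  fixes b c :: real
  assumes "\<And>s. 0 < s \<Longrightarrow> s < 1 \<Longrightarrow> 0 \<le> s * b + s\<^sup>2 * c"
  shows "0 \<le> b"
proof (rule tendsto_lowerbound)
  show "((\<lambda>s. b + s * c) \<longlongrightarrow> b) (at_right 0)"
    by (auto intro!: tendsto_eq_intros)
  have "0 \<le> b + s * c" if "0 < s" "s < 1" for s
  proof -
    have "0 \<le> s * (b + s * c)"
      using assms[OF that] by (simp add: algebra_simps power2_eq_square)
    then show ?thesis
      using that by (simp add: zero_le_mult_iff)
  qed
  then show "\<forall>\<^sub>F s in at_right 0. 0 \<le> b + s * c"
    by (auto simp: eventually_at_right[of 0 1] intro!: exI[of _ 1])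
qed simp

text \<open>Restricting \<open>l\<close> to the line through \<open>p\<close> and \<open>v\<close>
  reduces the claim to the tangent inequality in one variable, between the parameters 0 and
  1.\<close>

lemma convex_on_gradient_inequality:
  fixes l :: "'a::real_inner \<Rightarrow> real"
  assumes "convex_on UNIV l" and "GDERIV l p :> G"
  shows "l p + G \<bullet> (v - p) \<le> l v"
proof -
  define h where "h = (\<lambda>s::real. l (p + s *\<^sub>R (v - p)))"
  have "convex_on UNIV h"
  proof
    fix t x y :: real
    assume "t > 0" "t < 1"
    have "p + ((1 - t) * x + t * y) *\<^sub>R (v - p)
        = (1 - t) *\<^sub>R (p + x *\<^sub>R (v - p)) + t *\<^sub>R (p + y *\<^sub>R (v - p))"
      by (simp add: algebra_simps)
    then show "h ((1 - t) *\<^sub>R x + t *\<^sub>R y) \<le> (1 - t) * h x + t * h y"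
      using convex_onD[OF assms(1), of t] \<open>t > 0\<close> \<open>t < 1\<close> by (simp add: h_def)
  qed simp
  moreover have "(h has_field_derivative G \<bullet> (v - p)) (at 0 within UNIV)"
  proof -
    have l': "(l has_derivative (\<lambda>h. h \<bullet> G)) (at (p + 0 *\<^sub>R (v - p)))"
      using assms(2) by (simp add: gderiv_def)
    have "((\<lambda>s::real. p + s *\<^sub>R (v - p)) has_derivative (\<lambda>s. s *\<^sub>R (v - p))) (at 0)"
      by (auto intro!: derivative_eq_intros)
    from has_derivative_compose[OF this l'] show ?thesis
      unfolding has_field_derivative_def h_def
      by (rule has_derivative_eq_rhs) (auto simp: inner_commute mult.commute)
  qed
  ultimately have "h 1 - h 0 \<ge> (G \<bullet> (v - p)) * (1 - 0)"
    by (intro convex_on_imp_above_tangent[of UNIV]) auto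
  then show ?thesis
    by (simp add: h_def)
qed

lemma strictly_convex_fun_imp_convex_on:
  assumes "strictly_convex_fun (\<lambda>z. ereal (l z))"
  shows "convex_on UNIV l"
proof
  fix t :: real and x y
  assume t: "t > 0" "t < 1"
  show "l ((1 - t) *\<^sub>R x + t *\<^sub>R y) \<le> (1 - t) * l x + t * l y"
  proof (cases "x = y")
    case True
    then show ?thesis
      by (simp flip: scaleR_left.add add: algebra_simps)
  next
    case False
    then show ?thesis
      using assms t unfolding strictly_convex_fun_def effective_domain_def by force
  qed
qed simp

lemma convex_funD:
  assumes "convex_fun g" and "g x \<le> ereal r" "g y \<le> ereal q" and "0 \<le> s" "s \<le> 1"
  shows "g ((1 - s) *\<^sub>R x + s *\<^sub>R y) \<le> ereal ((1 - s) * r + s * q)"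
  using convexD[of "epi g" "(x, r)" "(y, q)" "1 - s" s] assms
  by (simp add: convex_fun_def epi_def)

section \<open>The proximity operator: existence and optimality\<close>

text \<open>Separate the closed convex epigraph from a point one unit below the graph. The
  separating hyperplane is not vertical, so it can be solved for the last coordinate.\<close>

lemma closed_convex_fun_affine_minorant:
  fixes g :: "'a::euclidean_space \<Rightarrow> ereal"
  assumes "closed_fun g" "proper_fun g" "convex_fun g"
  obtains p b where "\<And>x. ereal (p \<bullet> x + b) \<le> g x"
proof -
  obtain x0 r0 where x0: "g x0 = ereal r0"
    using assms(2) unfolding proper_fun_def by (metis ereal_cases)
  have "(x0, r0 - 1) \<notin> epi g"
    by (simp add: epi_def x0)
  then obtain c \<beta> where sep: "c \<bullet> (x0, r0 - 1) < \<beta>" "\<And>z. z \<in> epi g \<Longrightarrow> \<beta> < c \<bullet> z"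
    using separating_hyperplane_closed_point[of "epi g"] assms(1,3)
    unfolding closed_fun_def convex_fun_def by metis
  obtain p q where c: "c = (p, q)"
    by (cases c)
  have "(x0, r0) \<in> epi g"
    by (simp add: epi_def x0)
  \<comment> \<open>The two points differ only in the last coordinate, so the terms with
    \<open>p\<close> cancel and \<open>q * (r0 - 1) < q * r0\<close> remains.\<close>
  from sep(2)[OF this] sep(1) have "0 < q"
    by (simp add: c algebra_simps)
  have "ereal ((- (1 / q) *\<^sub>R p) \<bullet> x + \<beta> / q) \<le> g x" for x
  proof (cases "g x")
    case (real r)
    then have "\<beta> < p \<bullet> x + q * r"
      using sep(2)[of "(x, r)"] by (simp add: epi_def c)
    then show ?thesis
      using \<open>0 < q\<close> by (simp add: real field_simps)
  qed (use assms(2) in \<open>auto simp: proper_fun_def\<close>)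
  then show thesis
    by (rule that)
qed

text \<open>Since \<open>prox\<close> is a choice among minimizers, it is meaningful only once a
  minimizer exists. One is found by compactness: the affine minorant keeps \<open>g\<close> from
  outweighing the quadratic term.\<close>

lemma is_arg_min_prox:
  fixes g :: "'a::euclidean_space \<Rightarrow> ereal"
  assumes "closed_fun g" "proper_fun g" "convex_fun g"
  shows "is_arg_min (\<lambda>x. ereal (1/2 * (norm (y - x))\<^sup>2) + g x) (\<lambda>_. True) (prox g y)"
proof -
  obtain p b where minorant: "\<And>x. ereal (p \<bullet> x + b) \<le> g x"
    using closed_convex_fun_affine_minorant[OF assms] by blast
  obtain x0 r0 where x0: "g x0 = ereal r0"
    using assms(2) unfolding proper_fun_def by (metis ereal_cases)
  \<comment> \<open>Moving the value of \<open>g\<close> into a second coordinate gives a continuous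
    objective on the closed epigraph, although \<open>g\<close> itself is only lower
    semicontinuous.\<close>
  define F where "F = (\<lambda>z::'a \<times> real. 1/2 * (norm (y - fst z))\<^sup>2 + snd z)"
  define K where "K = epi g \<inter> {z. F z \<le> F (x0, r0)}"
  have cont: "continuous_on S F" for S
    unfolding F_def by (intro continuous_intros)
  have "closed K"
    unfolding K_def using assms(1) closed_fun_def
    by (intro closed_Int closed_Collect_le cont continuous_intros) auto
  moreover have "bounded K"
  proof -
    \<comment> \<open>Completing the square: with \<open>p \<bullet> x + b \<le> r\<close>, the
      level bound on \<open>F\<close> places \<open>x\<close> at squared distance at most
      \<open>2 * M\<close> from \<open>y - p\<close>. The minorant and Cauchy-Schwarz then bound
      \<open>r\<close> from below.\<close>
    define M where "M = F (x0, r0) - b - p \<bullet> y + (norm p)\<^sup>2 / 2"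
    define R where "R = sqrt (2 * M)"
    have "z \<in> cball (y - p) R \<times> {b - norm p * (norm (y - p) + R) .. F (x0, r0)}"
      if "z \<in> K" for z
    proof -
      obtain x r where z: "z = (x, r)" by (cases z)
      have "g x \<le> ereal r" and F: "F z \<le> F (x0, r0)"
        using that by (auto simp: K_def epi_def z)
      then have r: "p \<bullet> x + b \<le> r"
        using minorant[of x] order_trans by force
      have "(norm (x - (y - p)))\<^sup>2 = (norm (y - x))\<^sup>2 + 2 * (p \<bullet> x) - 2 * (p \<bullet> y) + (norm p)\<^sup>2"
        by (simp add: power2_norm_eq_inner algebra_simps inner_commute)
      then have "(norm (x - (y - p)))\<^sup>2 \<le> 2 * M"
        using r F by (simp add: M_def F_def z)
      then have R: "norm (x - (y - p)) \<le> R"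
        unfolding R_def by (rule real_le_rsqrt)
      have "norm x \<le> norm (y - p) + R"
        using R norm_triangle_sub[of x "y - p"] by linarith
      then have "norm p * norm x \<le> norm p * (norm (y - p) + R)"
        by (intro mult_left_mono) auto
      then have "b - norm p * (norm (y - p) + R) \<le> r"
        using r Cauchy_Schwarz_ineq2[of p x] by linarith
      moreover have "r \<le> F (x0, r0)"
        using F zero_le_power2[of "norm (y - x)"] unfolding F_def z fst_conv snd_conv by linarith
      ultimately show ?thesis
        using R by (simp add: z dist_norm norm_minus_commute)
    qed
    then have "K \<subseteq> cball (y - p) R \<times> {b - norm p * (norm (y - p) + R) .. F (x0, r0)}"
      by blast
    then show ?thesis
      by (rule bounded_subset[rotated]) (intro bounded_Times bounded_cball bounded_closed_interval)
  qed
  ultimately have "compact K"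
    by (simp add: compact_eq_bounded_closed)
  moreover have "(x0, r0) \<in> K"
    by (simp add: K_def epi_def x0)
  ultimately obtain z where "z \<in> K" and z_min: "\<And>z'. z' \<in> K \<Longrightarrow> F z \<le> F z'"
    using continuous_attains_inf[OF _ _ cont, of K] by blast
  obtain x r where z: "z = (x, r)" by (cases z)
  have "is_arg_min (\<lambda>x. ereal (1/2 * (norm (y - x))\<^sup>2) + g x) (\<lambda>_. True) x"
  proof -
    have "ereal (1/2 * (norm (y - x))\<^sup>2) + g x \<le> ereal (F z)"
      using \<open>z \<in> K\<close> by (auto simp: K_def epi_def z F_def add_left_mono
          simp flip: plus_ereal.simps(1))
    moreover have "ereal (F z) \<le> ereal (1/2 * (norm (y - x'))\<^sup>2) + g x'" for x'
    proof (cases "g x'")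
      case (real r')
      have "F z \<le> F (x', r')"
      proof (cases "(x', r') \<in> K")
        case False
        then have "F (x0, r0) \<le> F (x', r')"
          by (simp add: K_def epi_def real)
        with z_min[OF \<open>(x0, r0) \<in> K\<close>] show ?thesis
          by linarith
      qed (rule z_min)
      then show ?thesis
        by (simp add: real F_def)
    qed (use assms(2) in \<open>auto simp: proper_fun_def\<close>)
    ultimately show ?thesis
      unfolding is_arg_min_linorder using order_trans by blast
  qed
  then show ?thesis
    unfolding prox_def arg_min_def by (rule someI)
qed

text \<open>Compare the minimizer with points on the segment towards \<open>v\<close>. Convexity
  bounds \<open>g\<close> there, and the linear terms in the segment parameter give the subgradient
  inequality.\<close>

lemma prox_subgradient:
  fixes g :: "'a::euclidean_space \<Rightarrow> ereal"
  assumes "closed_fun g" "proper_fun g" "convex_fun g"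
  obtains r where "g (prox g y) = ereal r"
    and "\<And>v. ereal (r + (y - prox g y) \<bullet> (v - prox g y)) \<le> g v"
proof -
  define x where "x = prox g y"
  have x_min: "ereal (1/2 * (norm (y - x))\<^sup>2) + g x \<le> ereal (1/2 * (norm (y - v))\<^sup>2) + g v" for v
    using is_arg_min_prox[OF assms, of y] by (simp add: is_arg_min_linorder x_def)
  obtain x0 r0 where x0: "g x0 = ereal r0"
    using assms(2) unfolding proper_fun_def by (metis ereal_cases)
  obtain r where r: "g x = ereal r"
    using x_min[of x0] assms(2) by (cases "g x") (auto simp: x0 proper_fun_def)
  have "ereal (r + (y - x) \<bullet> (v - x)) \<le> g v" for v
  proof (cases "g v")
    case (real q)
    have "0 \<le> s * (q - r - (y - x) \<bullet> (v - x)) + s\<^sup>2 * (1/2 * (norm (v - x))\<^sup>2)"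
      if "0 < s" "s < 1" for s
    proof -
      define u where "u = (1 - s) *\<^sub>R x + s *\<^sub>R v"
      have "g u \<le> ereal ((1 - s) * r + s * q)"
        unfolding u_def using that by (intro convex_funD assms(3)) (auto simp: r real)
      then have "ereal (1/2 * (norm (y - x))\<^sup>2) + ereal r
          \<le> ereal (1/2 * (norm (y - u))\<^sup>2) + ereal ((1 - s) * r + s * q)"
        using x_min[of u] unfolding r by (meson add_left_mono order_trans)
      moreover have "y - u = (y - x) - s *\<^sub>R (v - x)"
        by (simp add: u_def algebra_simps)
      then have "(norm (y - u))\<^sup>2
          = (norm (y - x))\<^sup>2 - 2 * s * ((y - x) \<bullet> (v - x)) + s\<^sup>2 * (norm (v - x))\<^sup>2"
        by (simp only: power2_norm_eq_inner inner_diff_left inner_diff_right inner_scaleR_left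
            inner_scaleR_right)
          (simp add: inner_commute algebra_simps power2_eq_square)
      ultimately show ?thesis
        by (simp add: algebra_simps)
    qed
    then have "0 \<le> q - r - (y - x) \<bullet> (v - x)"
      by (rule nonneg_if_quadratic_nonneg_near_0)
    then show ?thesis
      by (simp add: real)
  qed (use assms(2) in \<open>auto simp: proper_fun_def\<close>)
  with r show thesis
    using that unfolding x_def by blast
qed

section \<open>Conjugates, Moreau envelopes and the inner problem\<close>

lemma conjugate_upper: "ereal (y \<bullet> x) - g x \<le> conjugate g y"
  unfolding conjugate_def by (rule SUP_upper) simp

text \<open>Fenchel equality: rearranged, the subgradient inequality says that \<open>p\<close>
  attains the supremum in the conjugate.\<close>

lemma conjugate_subgradient_eq:
  assumes "g p = ereal r" and "\<And>v. ereal (r + y \<bullet> (v - p)) \<le> g v"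
  shows "conjugate g y = ereal (y \<bullet> p - r)"
proof (rule antisym)
  show "conjugate g y \<le> ereal (y \<bullet> p - r)"
    unfolding conjugate_def
  proof (rule SUP_least)
    fix x
    show "ereal (y \<bullet> x) - g x \<le> ereal (y \<bullet> p - r)"
      using assms(2)[of x] by (cases "g x") (auto simp: algebra_simps)
  qed
  show "ereal (y \<bullet> p - r) \<le> conjugate g y"
    using conjugate_upper[of y p g] by (simp add: assms(1))
qed

text \<open>The minimum defining the envelope at \<open>u\<close> is attained at \<open>u - p\<close> when \<open>u - p\<close> is a subgradient
  of \<open>g\<close> at \<open>p\<close> (Moreau decomposition).\<close>

lemma moreau_envelope_conjugate_eq:
  assumes "g p = ereal r" and "\<And>v. ereal (r + (u - p) \<bullet> (v - p)) \<le> g v"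
  shows "moreau_envelope (conjugate g) u = ereal ((u - p) \<bullet> p - r + 1/2 * (norm p)\<^sup>2)"
proof (rule antisym)
  show "moreau_envelope (conjugate g) u \<le> ereal ((u - p) \<bullet> p - r + 1/2 * (norm p)\<^sup>2)"
    unfolding moreau_envelope_def
    by (rule INF_lower2[of "u - p"]) (simp_all add: conjugate_subgradient_eq[OF assms])
  show "ereal ((u - p) \<bullet> p - r + 1/2 * (norm p)\<^sup>2) \<le> moreau_envelope (conjugate g) u"
    unfolding moreau_envelope_def
  proof (rule INF_greatest)
    fix x
    \<comment> \<open>\<open>x - u + p\<close> is the offset of \<open>x\<close> from the claimed
      minimizer \<open>u - p\<close>. Expanding its square yields the bound once Fenchel-Young at
      \<open>p\<close> is added.\<close>
    have "0 \<le> (norm (x - u + p))\<^sup>2"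
      by simp
    also have "(norm (x - u + p))\<^sup>2 = (norm (x - u))\<^sup>2 + 2 * ((x - u + p) \<bullet> p) - (norm p)\<^sup>2"
      by (simp add: power2_norm_eq_inner algebra_simps inner_commute)
    finally have "(u - p) \<bullet> p - r + 1/2 * (norm p)\<^sup>2 \<le> (x \<bullet> p - r) + 1/2 * (norm (x - u))\<^sup>2"
      by (simp add: algebra_simps)
    then have "ereal ((u - p) \<bullet> p - r + 1/2 * (norm p)\<^sup>2)
        \<le> ereal (x \<bullet> p - r) + ereal (1/2 * (norm (x - u))\<^sup>2)"
      by simp
    also have "\<dots> \<le> conjugate g x + ereal (1/2 * (norm (x - u))\<^sup>2)"
      using conjugate_upper[of x p g] by (intro add_right_mono) (simp add: assms(1))
    finally show "ereal ((u - p) \<bullet> p - r + 1/2 * (norm p)\<^sup>2)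
        \<le> conjugate g x + ereal (1/2 * (norm (x - u))\<^sup>2)" .
  qed
qed

text \<open>The point \<open>u - p\<close>, optimal for \<open>u\<close>, serves as a trial point
  for \<open>u + h\<close>. The resulting one-sided expansion with slope \<open>p\<close> takes the
  place of a gradient formula for the envelope.\<close>

lemma moreau_envelope_conjugate_upper:
  assumes "g p = ereal r" and "\<And>v. ereal (r + (u - p) \<bullet> (v - p)) \<le> g v"
  shows "moreau_envelope (conjugate g) (u + h)
    \<le> ereal ((u - p) \<bullet> p - r + 1/2 * (norm p)\<^sup>2 + p \<bullet> h + 1/2 * (norm h)\<^sup>2)"
proof -
  have "moreau_envelope (conjugate g) (u + h)
      \<le> conjugate g (u - p) + ereal (1/2 * (norm (u - p - (u + h)))\<^sup>2)"
    unfolding moreau_envelope_def by (rule INF_lower) simp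
  also have "u - p - (u + h) = - (p + h)"
    by simp
  also have "(norm (- (p + h)))\<^sup>2 = (norm p)\<^sup>2 + 2 * (p \<bullet> h) + (norm h)\<^sup>2"
    by (simp only: power2_norm_eq_inner inner_minus_left inner_minus_right)
      (simp add: algebra_simps inner_commute)
  finally show ?thesis
    by (simp add: conjugate_subgradient_eq[OF assms] algebra_simps)
qed

text \<open>The inner objective is compared only along the segment from \<open>- a\<close> to \<open>G (A *v x)\<close>, where the
  envelope has a quadratic upper bound with slope \<open>x\<close>. That gives Fenchel equality at \<open>(A *v x, - a)\<close>,
  so neither biconjugation nor differentiability of the conjugate is needed.\<close>

lemma inner_minimizer_loss_subgradient:
  fixes A :: "real^'n^'m" and l :: "real^'m \<Rightarrow> real"
  assumes "convex_on UNIV l" and "\<And>z. GDERIV l z :> G z" and "0 < \<eta>"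
    and r: "\<phi> (lam * \<eta>) x = ereal r"
    and x: "\<And>v. ereal (r + (w + \<eta> *\<^sub>R (transpose A *v a) - x) \<bullet> (v - x)) \<le> \<phi> (lam * \<eta>) v"
    and a_min: "a \<in> minimizers (inner_objective (\<lambda>z. ereal (l z)) \<phi> lam A \<eta> w)"
  shows "l (A *v x) - a \<bullet> (v - A *v x) \<le> l v"
proof -
  define h where "h = conjugate (\<lambda>z. ereal (l z))"
  define p where "p = A *v x"
  define u where "u = w + \<eta> *\<^sub>R (transpose A *v a)"
  define M where "M = (u - x) \<bullet> x - r + 1/2 * (norm x)\<^sup>2"
  \<comment> \<open>The gradient \<open>G p\<close> is a subgradient of \<open>l\<close> at
    \<open>p\<close>, so Fenchel equality applies.\<close>
  have h_G: "h (G p) = ereal (G p \<bullet> p - l p)"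
    unfolding h_def using convex_on_gradient_inequality[OF assms(1,2), of p]
    by (intro conjugate_subgradient_eq) auto
  have h_ge: "ereal (b \<bullet> z - l z) \<le> h b" for b z
    using conjugate_upper[of b z "\<lambda>z. ereal (l z)"] by (simp add: h_def)
  have env: "moreau_envelope (conjugate (\<phi> (lam * \<eta>))) u = ereal M"
    unfolding M_def by (rule moreau_envelope_conjugate_eq[where g = "\<phi> (lam * \<eta>)"])
      (use r x in \<open>simp_all add: u_def\<close>)
  have env_upper: "moreau_envelope (conjugate (\<phi> (lam * \<eta>))) (u + k)
      \<le> ereal (M + x \<bullet> k + 1/2 * (norm k)\<^sup>2)" for k
    unfolding M_def
    by (rule moreau_envelope_conjugate_upper[where g = "\<phi> (lam * \<eta>)"])
      (use r x in \<open>simp_all add: u_def\<close>)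
  have opt: "h (- a) + ereal (M / \<eta>)
      \<le> h (- b) + ereal ((M + \<eta> * (p \<bullet> (b - a)) + 1/2 * (norm (\<eta> *\<^sub>R (transpose A *v (b - a))))\<^sup>2) / \<eta>)"
    for b
  proof -
    have "w + \<eta> *\<^sub>R (transpose A *v b) = u + \<eta> *\<^sub>R (transpose A *v (b - a))"
      by (simp add: u_def matrix_vector_mult_diff_distrib algebra_simps del: transpose_matrix_vector)
    moreover have "x \<bullet> (\<eta> *\<^sub>R (transpose A *v (b - a))) = \<eta> * (p \<bullet> (b - a))"
      by (simp add: p_def dot_lmul_matrix inner_commute[of x] inner_commute[of "A *v x"])
    ultimately have "moreau_envelope (conjugate (\<phi> (lam * \<eta>))) (w + \<eta> *\<^sub>R (transpose A *v b))
        \<le> ereal (M + \<eta> * (p \<bullet> (b - a)) + 1/2 * (norm (\<eta> *\<^sub>R (transpose A *v (b - a))))\<^sup>2)"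
      using env_upper by metis
    then have "ereal (1 / \<eta>) * moreau_envelope (conjugate (\<phi> (lam * \<eta>))) (w + \<eta> *\<^sub>R (transpose A *v b))
        \<le> ereal (1 / \<eta>) * ereal (M + \<eta> * (p \<bullet> (b - a)) + 1/2 * (norm (\<eta> *\<^sub>R (transpose A *v (b - a))))\<^sup>2)"
      using \<open>0 < \<eta>\<close> by (intro ereal_mult_left_mono) auto
    then have "inner_objective (\<lambda>z. ereal (l z)) \<phi> lam A \<eta> w b
        \<le> h (- b) + ereal ((M + \<eta> * (p \<bullet> (b - a)) + 1/2 * (norm (\<eta> *\<^sub>R (transpose A *v (b - a))))\<^sup>2) / \<eta>)"
      unfolding inner_objective_def h_def by (intro add_left_mono) simp
    moreover have "inner_objective (\<lambda>z. ereal (l z)) \<phi> lam A \<eta> w a = h (- a) + ereal (M / \<eta>)"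
      using env unfolding inner_objective_def h_def u_def by simp
    moreover have "inner_objective (\<lambda>z. ereal (l z)) \<phi> lam A \<eta> w a
        \<le> inner_objective (\<lambda>z. ereal (l z)) \<phi> lam A \<eta> w b"
      using a_min by (simp add: minimizers_def is_arg_min_linorder)
    ultimately show ?thesis
      by simp
  qed
  \<comment> \<open>Comparison with the competitor \<open>- G p\<close>, whose conjugate value is
    finite, bounds \<open>h (- a)\<close> from above. The term at 0 in the supremum bounds it from
    below.\<close>
  obtain H where H: "h (- a) = ereal H"
    using opt[of "- G p"] h_ge[of "- a" 0] by (cases "h (- a)") (auto simp: h_G)
  have "0 \<le> s * (G p \<bullet> p - l p - H - p \<bullet> (G p + a)) + s\<^sup>2 * (\<eta> / 2 * (norm (transpose A *v (G p + a)))\<^sup>2)"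
    if s: "0 < s" "s < 1" for s
  proof -
    \<comment> \<open>With this choice \<open>- b\<close> equals
      \<open>(1 - s) *\<^sub>R (- a) + s *\<^sub>R G p\<close>.\<close>
    define b where "b = a - s *\<^sub>R (G p + a)"
    \<comment> \<open>Every term of the supremum is affine in the dual variable, so convexity of the
      conjugate is checked term by term.\<close>
    have "h (- b) \<le> ereal ((1 - s) * H + s * (G p \<bullet> p - l p))"
      unfolding h_def conjugate_def
    proof (rule SUP_least)
      fix z
      have "- a \<bullet> z - l z \<le> H" "G p \<bullet> z - l z \<le> G p \<bullet> p - l p"
        using h_ge[of "- a" z] h_ge[of "G p" z] by (auto simp: H h_G)
      then have "(1 - s) * (- a \<bullet> z - l z) + s * (G p \<bullet> z - l z)
          \<le> (1 - s) * H + s * (G p \<bullet> p - l p)"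
        using s by (intro add_mono mult_left_mono) auto
      moreover have "- b \<bullet> z - l z = (1 - s) * (- a \<bullet> z - l z) + s * (G p \<bullet> z - l z)"
        by (simp add: b_def algebra_simps)
      ultimately show "ereal (- b \<bullet> z) - ereal (l z) \<le> ereal ((1 - s) * H + s * (G p \<bullet> p - l p))"
        by simp
    qed
    then have "h (- a) + ereal (M / \<eta>) \<le> ereal ((1 - s) * H + s * (G p \<bullet> p - l p))
        + ereal ((M + \<eta> * (p \<bullet> (b - a)) + 1/2 * (norm (\<eta> *\<^sub>R (transpose A *v (b - a))))\<^sup>2) / \<eta>)"
      by (intro order_trans[OF opt[of b] add_right_mono])
    then have "H + M / \<eta> \<le> (1 - s) * H + s * (G p \<bullet> p - l p)
        + (M + \<eta> * (p \<bullet> (b - a)) + 1/2 * (norm (\<eta> *\<^sub>R (transpose A *v (b - a))))\<^sup>2) / \<eta>"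
      by (simp add: H)
    moreover have "b - a = (- s) *\<^sub>R (G p + a)"
      by (simp add: b_def)
    then have "p \<bullet> (b - a) = - (s * (p \<bullet> (G p + a)))"
      and "(norm (\<eta> *\<^sub>R (transpose A *v (b - a))))\<^sup>2
        = \<eta>\<^sup>2 * (s\<^sup>2 * (norm (transpose A *v (G p + a)))\<^sup>2)"
      by (simp_all only: matrix_vector_mult_scaleR inner_scaleR_right norm_scaleR
          power_mult_distrib power2_abs power2_minus mult_minus_left)
    moreover have "(M + \<eta> * x + 1/2 * (\<eta>\<^sup>2 * y)) / \<eta> = M / \<eta> + x + \<eta> / 2 * y" for x y
      using \<open>0 < \<eta>\<close> by (simp add: field_simps power2_eq_square)
    ultimately have "H + M / \<eta> \<le> (1 - s) * H + s * (G p \<bullet> p - l p)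
        + (M / \<eta> + - (s * (p \<bullet> (G p + a))) + \<eta> / 2 * (s\<^sup>2 * (norm (transpose A *v (G p + a)))\<^sup>2))"
      by (simp only:)
    then show ?thesis
      by (simp add: algebra_simps)
  qed
  \<comment> \<open>The contributions of \<open>G p\<close> cancel here. What remains is the
    nontrivial half of Fenchel equality at \<open>- a\<close>, and Fenchel-Young at \<open>v\<close>
    turns it into the subgradient inequality.\<close>
  then have "0 \<le> G p \<bullet> p - l p - H - p \<bullet> (G p + a)"
    by (rule nonneg_if_quadratic_nonneg_near_0)
  then have "H \<le> - (a \<bullet> p) - l p"
    by (simp add: algebra_simps inner_commute)
  moreover have "- (a \<bullet> v) - l v \<le> H"
    using h_ge[of "- a" v] by (simp add: H)
  ultimately show ?thesis
    by (simp add: p_def algebra_simps)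
qed

section \<open>Distances to the solution set and the scalar recursion\<close>

text \<open>Write \<open>x - y\<close> as \<open>(x - x') + (x' - y') - (y - y')\<close> with the
  projections \<open>x'\<close>, \<open>y'\<close>, and pair it with \<open>y - y'\<close>. The
  middle term is nonpositive by the obtuse angle property of projections, the first is bounded by
  Cauchy-Schwarz, and the assumption is applied at \<open>y'\<close>.\<close>

lemma infdist_descent:
  fixes S :: "'a::euclidean_space set"
  assumes "convex S" "closed S" "S \<noteq> {}" and le: "\<And>v. v \<in> S \<Longrightarrow> c \<le> (x - y) \<bullet> (y - v)"
  shows "(infdist y S)\<^sup>2 + c \<le> infdist x S * infdist y S"
proof -
  define x' where "x' = closest_point S x"
  define y' where "y' = closest_point S y"
  have in_S: "x' \<in> S" "y' \<in> S"
    unfolding x'_def y'_def by (intro closest_point_in_set assms)+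
  have d: "infdist x S = norm (x - x')" "infdist y S = norm (y - y')"
    unfolding x'_def y'_def infdist_eq_setdist using assms
    by (simp_all add: setdist_closest_point dist_norm)
  have "(y - y') \<bullet> (x' - y') \<le> 0"
    unfolding y'_def using in_S assms by (intro closest_point_dot) auto
  moreover have "(x - y) \<bullet> (y - y')
      = (x - x') \<bullet> (y - y') + (y - y') \<bullet> (x' - y') - (y - y') \<bullet> (y - y')"
    by (simp add: algebra_simps inner_commute)
  moreover have "(x - x') \<bullet> (y - y') \<le> norm (x - x') * norm (y - y')"
    by (rule norm_cauchy_schwarz)
  ultimately show ?thesis
    using le[OF in_S(2)] by (simp add: d power2_norm_eq_inner)
qed

lemma distance_powr_step:
  fixes d d' :: real
  assumes "0 \<le> d" "0 \<le> d'" and "d'\<^sup>2 + c * d' powr \<alpha> \<le> d * d'"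
  shows "d' + c * d' powr (\<alpha> - 1) \<le> d"
proof (cases "d' = 0")
  case False
  then have "0 < d'"
    using assms(2) by simp
  then have "d' powr \<alpha> = d' * d' powr (\<alpha> - 1)"
    by (simp add: powr_mult_base)
  then have "d' * (d' + c * d' powr (\<alpha> - 1)) \<le> d' * d"
    using assms(3) by (simp add: algebra_simps power2_eq_square)
  then show ?thesis
    using \<open>0 < d'\<close> by simp
\<comment> \<open>Here \<open>0 powr (\<alpha> - 1)\<close> is 0 even for \<alpha> = 1, so the
  left-hand side vanishes.\<close>
qed (use assms(1) in simp)

text \<open>Weighted arithmetic-geometric mean of \<open>d\<close> and
  \<open>d powr (\<alpha> - 1)\<close> with weights \<open>1 / (1 + s)\<close> and
  \<open>s / (1 + s)\<close>, in the form of convexity of \<open>exp\<close> at the two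
  logarithms.\<close>

lemma powr_weighted_am_gm:
  fixes d s \<alpha> :: real
  assumes "0 \<le> d" "0 < s"
  shows "d powr ((1 + (\<alpha> - 1) * s) / (1 + s)) \<le> 1 / (1 + s) * (d + s * d powr (\<alpha> - 1))"
proof (cases "d = 0")
  case False
  then have "0 < d"
    using assms(1) by simp
  have "exp ((1 - s / (1 + s)) *\<^sub>R ln d + (s / (1 + s)) *\<^sub>R ((\<alpha> - 1) * ln d))
      \<le> (1 - s / (1 + s)) * exp (ln d) + s / (1 + s) * exp ((\<alpha> - 1) * ln d)"
    using assms(2) by (intro convex_onD[OF exp_convex]) auto
  moreover have "1 - s / (1 + s) = 1 / (1 + s)"
    using assms(2) by (simp add: field_simps)
  ultimately show ?thesis
    using \<open>0 < d\<close> by (simp add: powr_def add_divide_distrib distrib_right distrib_left mult_ac)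
qed simp

text \<open>The mean inequality bounds the power of \<open>d'\<close> by the left side of the
  recursion. The exponent is positive, so the power can be inverted, which gives the explicit
  rate.\<close>

lemma powr_rate_step:
  fixes d d' s \<alpha> :: real
  assumes "0 \<le> d'" "0 < s" "1 \<le> \<alpha>" and "d' + s * d' powr (\<alpha> - 1) \<le> d"
  shows "d' powr ((1 + (\<alpha> - 1) * s) / (1 + s)) \<le> 1 / (1 + s) * d"
    and "d' \<le> (1 / (1 + s) * d) powr ((1 + s) / (1 + (\<alpha> - 1) * s))"
proof -
  let ?e = "(1 + (\<alpha> - 1) * s) / (1 + s)"
  have "0 < 1 + (\<alpha> - 1) * s"
    using assms by (intro add_pos_nonneg) auto
  show le: "d' powr ?e \<le> 1 / (1 + s) * d"
    using powr_weighted_am_gm[OF assms(1,2), of \<alpha>] assms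
    by (meson divide_nonneg_nonneg add_nonneg_nonneg less_imp_le mult_left_mono order_trans zero_le_one)
  have "d' = (d' powr ?e) powr (1 / ?e)"
    using \<open>0 < 1 + (\<alpha> - 1) * s\<close> assms by (simp add: powr_powr)
  also have "\<dots> \<le> (1 / (1 + s) * d) powr (1 / ?e)"
    using le \<open>0 < 1 + (\<alpha> - 1) * s\<close> assms by (intro powr_mono2) auto
  finally show "d' \<le> (1 / (1 + s) * d) powr ((1 + s) / (1 + (\<alpha> - 1) * s))"
    by simp
qed

text \<open>The sequence decreases and is bounded below. Passing to the limit in the recursion
  leaves \<open>s * L powr (\<alpha> - 1) \<le> 0\<close>, which excludes a positive limit.\<close>

lemma powr_recursion_tendsto_0:
  fixes d :: "nat \<Rightarrow> real"
  assumes nonneg: "\<And>t. 0 \<le> d t" and "0 < s" "1 \<le> \<alpha>"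
    and step: "\<And>t. d (Suc t) + s * d (Suc t) powr (\<alpha> - 1) \<le> d t"
  shows "d \<longlonglongrightarrow> 0"
proof -
  have "0 \<le> s * d (Suc t) powr (\<alpha> - 1)" for t
    using assms by simp
  then have "decseq d"
    using step by (intro decseq_SucI) (smt (verit))
  then have "\<exists>L. d \<longlonglongrightarrow> L"
    using decseq_convergent[of d 0] nonneg by metis
  then obtain L where L: "d \<longlonglongrightarrow> L" by blast
  then have L': "(\<lambda>t. d (Suc t)) \<longlonglongrightarrow> L"
    by (rule LIMSEQ_Suc)
  have "0 \<le> L"
    using L nonneg by (intro tendsto_lowerbound[OF L]) auto
  have "L = 0"
  proof (rule ccontr)
    \<comment> \<open>Continuity of the power at \<open>L\<close> relies on this: for \<alpha> = 1
      it jumps at 0.\<close>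
    assume "L \<noteq> 0"
    then have "(\<lambda>t. d (Suc t) + s * d (Suc t) powr (\<alpha> - 1)) \<longlonglongrightarrow> L + s * L powr (\<alpha> - 1)"
      by (intro tendsto_intros L') auto
    then have "L + s * L powr (\<alpha> - 1) \<le> L"
      using step by (intro tendsto_le[OF _ L]) auto
    then show False
      using \<open>0 \<le> L\<close> \<open>L \<noteq> 0\<close> \<open>0 < s\<close> by (simp add: mult_le_0_iff powr_eq_0_iff)
  qed
  then show ?thesis
    using L by simp
qed

text \<open>For \<alpha> < 2 the term \<open>s * d (Suc t) powr (\<alpha> - 1)\<close> eventually
  dominates any fixed multiple of \<open>d (Suc t)\<close>, because the distances tend to 0.\<close>

lemma powr_recursion_superlinear:
  fixes d :: "nat \<Rightarrow> real"
  assumes nonneg: "\<And>t. 0 \<le> d t" and "0 < s" "1 \<le> \<alpha>" "\<alpha> < 2"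
    and step: "\<And>t. d (Suc t) + s * d (Suc t) powr (\<alpha> - 1) \<le> d t" and "0 < e"
  shows "\<forall>\<^sub>F t in sequentially. d (Suc t) \<le> e * d t"
proof -
  have d0: "d \<longlonglongrightarrow> 0"
    using assms by (intro powr_recursion_tendsto_0[of d s \<alpha>]) auto
  \<comment> \<open>Chosen to solve \<open>\<delta> powr (2 - \<alpha>) = s * e\<close>.\<close>
  define \<delta> where "\<delta> = (s * e) powr (1 / (2 - \<alpha>))"
  have "0 < \<delta>"
    unfolding \<delta>_def using assms by simp
  then have "\<forall>\<^sub>F t in sequentially. d (Suc t) < \<delta>"
    by (rule order_tendstoD(2)[OF LIMSEQ_Suc[OF d0]])
  then show ?thesis
  proof eventually_elim
    case (elim t)
    show ?case
    proof (cases "d (Suc t) = 0")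
      case False
      then have pos: "0 < d (Suc t)"
        using nonneg[of "Suc t"] by simp
      have "d (Suc t) powr (2 - \<alpha>) \<le> \<delta> powr (2 - \<alpha>)"
        using elim pos assms by (intro powr_mono2) auto
      also have "\<dots> = s * e"
        unfolding \<delta>_def using assms by (simp add: powr_powr)
      finally have "d (Suc t) powr (2 - \<alpha>) * d (Suc t) powr (\<alpha> - 1) \<le> s * e * d (Suc t) powr (\<alpha> - 1)"
        by (intro mult_right_mono) auto
      then have "d (Suc t) \<le> e * (s * d (Suc t) powr (\<alpha> - 1))"
        using pos by (simp add: mult_ac flip: powr_add)
      also have "\<dots> \<le> e * d t"
        using step[of t] nonneg[of "Suc t"] \<open>0 < e\<close> by (intro mult_left_mono) auto
      finally show ?thesis .
    qed (use nonneg[of t] \<open>0 < e\<close> in simp)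
  qed
qed

section \<open>Positive multiples of the regularizer and the set of minimizers\<close>

lemma closed_fun_scale:
  fixes g :: "'a::topological_space \<Rightarrow> ereal"
  assumes "closed_fun g" "0 < c"
  shows "closed_fun (\<lambda>x. ereal c * g x)"
proof -
  have "epi (\<lambda>x. ereal c * g x) = (\<lambda>z. (fst z, snd z / c)) -` epi g"
  proof -
    have "ereal c * g x \<le> ereal r \<longleftrightarrow> g x \<le> ereal (r / c)" for x r
      using \<open>0 < c\<close> by (cases "g x") (auto simp: field_simps)
    then show ?thesis
      by (auto simp: epi_def)
  qed
  moreover have "closed ((\<lambda>z. (fst z, snd z / c)) -` epi g)"
    using assms unfolding closed_fun_def
    by (intro closed_vimage continuous_intros) auto
  ultimately show ?thesis
    by (simp add: closed_fun_def)
qed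

lemma proper_fun_scale:
  assumes "proper_fun g" "0 < c"
  shows "proper_fun (\<lambda>x. ereal c * g x)"
proof -
  have "(ereal c * g x = \<infinity> \<longleftrightarrow> g x = \<infinity>) \<and> (ereal c * g x = - \<infinity> \<longleftrightarrow> g x = - \<infinity>)" for x
    using \<open>0 < c\<close> by (cases "g x") auto
  then show ?thesis
    using assms(1) by (simp add: proper_fun_def)
qed

lemma convex_fun_scale:
  assumes "convex_fun g" "0 < c"
  shows "convex_fun (\<lambda>x. ereal c * g x)"
proof -
  have "epi (\<lambda>x. ereal c * g x) = (\<lambda>z. (fst z, c * snd z)) ` epi g"
  proof -
    have "ereal c * g x \<le> ereal r \<longleftrightarrow> g x \<le> ereal (r / c)" for x r
      using \<open>0 < c\<close> by (cases "g x") (auto simp: field_simps)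
    then show ?thesis
      using \<open>0 < c\<close> by (fastforce simp: epi_def image_iff)
  qed
  moreover have "linear (\<lambda>z::'a \<times> real. (fst z, c * snd z))"
    by (intro linearI) (auto simp: algebra_simps)
  ultimately show ?thesis
    using assms by (simp add: convex_fun_def convex_linear_image)
qed

text \<open>With a finite loss, the set of minimizers is the preimage of the epigraph of the
  regularizer under \<open>v \<mapsto> (v, m - l (A *v v))\<close>, where \<open>m\<close> is the
  minimum. This map is continuous and its last component is concave. Both properties are needed to
  project onto the set.\<close>

lemma minimizers_composite_closed_convex:
  fixes A :: "real^'n^'m" and l :: "real^'m \<Rightarrow> real"
  assumes "convex_on UNIV l" "continuous_on UNIV l"
    and "closed_fun (\<phi> lam)" "proper_fun (\<phi> lam)" "convex_fun (\<phi> lam)"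
  shows "closed (minimizers (objective (\<lambda>z. ereal (l z)) \<phi> lam A))"
    and "convex (minimizers (objective (\<lambda>z. ereal (l z)) \<phi> lam A))"
proof -
  let ?f = "objective (\<lambda>z. ereal (l z)) \<phi> lam A"
  let ?W = "minimizers ?f"
  have "closed ?W \<and> convex ?W"
  proof (cases "?W = {}")
    case False
    then obtain v0 where v0: "\<And>v. ?f v0 \<le> ?f v"
      by (auto simp: minimizers_def is_arg_min_linorder)
    obtain x0 r0 where x0: "\<phi> lam x0 = ereal r0"
      using assms(4) unfolding proper_fun_def by (metis ereal_cases)
    obtain m where m: "?f v0 = ereal m"
      using v0[of x0] assms(4) by (cases "\<phi> lam v0") (auto simp: objective_def x0 proper_fun_def)
    have "?W = {v. ?f v \<le> ereal m}"
      using v0 unfolding m by (auto simp: minimizers_def is_arg_min_linorder)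
        (metis m order_trans)+
    also have "\<dots> = (\<lambda>v. (v, m - l (A *v v))) -` epi (\<phi> lam)"
    proof -
      have "?f v \<le> ereal m \<longleftrightarrow> \<phi> lam v \<le> ereal (m - l (A *v v))" for v
        by (cases "\<phi> lam v") (auto simp: objective_def)
      then show ?thesis
        by (auto simp: epi_def)
    qed
    finally have W: "?W = (\<lambda>v. (v, m - l (A *v v))) -` epi (\<phi> lam)" .
    have "closed ?W"
      unfolding W using assms(3) unfolding closed_fun_def
      by (intro closed_vimage continuous_intros continuous_on_compose2[OF assms(2)]
          matrix_vector_mult_linear_continuous_on) auto
    moreover have "convex ?W"
    proof (rule convexI)
      fix x y and u t :: real
      assume xy: "x \<in> ?W" "y \<in> ?W" and u: "0 \<le> u" "0 \<le> t" "u + t = 1"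
      then have u': "u = 1 - t" by simp
      have "\<phi> lam ((1 - t) *\<^sub>R x + t *\<^sub>R y)
          \<le> ereal ((1 - t) * (m - l (A *v x)) + t * (m - l (A *v y)))"
        using xy u unfolding W by (intro convex_funD assms(5)) (auto simp: epi_def)
      moreover have "l (A *v ((1 - t) *\<^sub>R x + t *\<^sub>R y)) \<le> (1 - t) * l (A *v x) + t * l (A *v y)"
        using convex_onD[OF assms(1), of t "A *v x" "A *v y"] u
        by (simp add: matrix_vector_right_distrib matrix_vector_mult_scaleR)
      then have "ereal ((1 - t) * (m - l (A *v x)) + t * (m - l (A *v y)))
          \<le> ereal (m - l (A *v ((1 - t) *\<^sub>R x + t *\<^sub>R y)))"
        by (simp add: algebra_simps)
      ultimately have "\<phi> lam ((1 - t) *\<^sub>R x + t *\<^sub>R y)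
          \<le> ereal (m - l (A *v ((1 - t) *\<^sub>R x + t *\<^sub>R y)))"
        by (rule order_trans)
      then show "u *\<^sub>R x + t *\<^sub>R y \<in> ?W"
        unfolding W u' by (simp add: epi_def)
    qed
    ultimately show ?thesis by blast
  qed simp
  then show "closed ?W" "convex ?W" by auto
qed

section \<open>One exact step and the convergence theorem\<close>

text \<open>The scaled regularizer has the subgradient
  \<open>w + \<eta> *\<^sub>R (transpose A *v a) - x\<close> at \<open>x\<close>, and the loss has
  \<open>- a\<close> at \<open>A *v x\<close>. After division by \<eta> the terms in
  \<open>a\<close> cancel in the sum, leaving a proximal point step for \<open>f\<close>.\<close>

lemma exact_dal_step:
  fixes A :: "real^'n^'m" and l :: "real^'m \<Rightarrow> real"
    and \<phi> :: "real \<Rightarrow> real^'n \<Rightarrow> ereal" and lam :: real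
  defines "f \<equiv> objective (\<lambda>z. ereal (l z)) \<phi> lam A"
  assumes "convex_on UNIV l" and l': "\<And>z. GDERIV l z :> G z"
    and \<phi>: "closed_fun (\<phi> lam)" "proper_fun (\<phi> lam)" "convex_fun (\<phi> lam)"
    and scale: "\<And>c x. c > 0 \<Longrightarrow> \<phi> (c * lam) x = ereal c * \<phi> lam x"
    and "0 < \<eta>"
    and a_min: "a \<in> minimizers (inner_objective (\<lambda>z. ereal (l z)) \<phi> lam A \<eta> w)"
    and x_def: "x = prox (\<phi> (lam * \<eta>)) (w + \<eta> *\<^sub>R (transpose A *v a))"
  obtains r where "f x = ereal r" and "\<And>v. ereal (r + (w - x) \<bullet> (v - x) / \<eta>) \<le> f v"
proof -
  have \<phi>\<eta>: "\<phi> (lam * \<eta>) = (\<lambda>x. ereal \<eta> * \<phi> lam x)"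
    using scale[OF \<open>0 < \<eta>\<close>] by (auto simp: mult.commute)
  let ?u = "w + \<eta> *\<^sub>R (transpose A *v a)"
  obtain q where q: "\<phi> (lam * \<eta>) x = ereal q"
    and q_le: "\<And>v. ereal (q + (?u - x) \<bullet> (v - x)) \<le> \<phi> (lam * \<eta>) v"
  proof (rule prox_subgradient[of "\<phi> (lam * \<eta>)" ?u])
    show "closed_fun (\<phi> (lam * \<eta>))" "proper_fun (\<phi> (lam * \<eta>))" "convex_fun (\<phi> (lam * \<eta>))"
      unfolding \<phi>\<eta> using \<phi> \<open>0 < \<eta>\<close> by (simp_all add: closed_fun_scale proper_fun_scale convex_fun_scale)
  qed (auto simp: x_def)
  have l_ge: "l (A *v x) - a \<bullet> (A *v v - A *v x) \<le> l (A *v v)" for v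
    by (rule inner_minimizer_loss_subgradient[OF assms(2) l' \<open>0 < \<eta>\<close> q q_le a_min])
  have x: "\<phi> lam x = ereal (q / \<eta>)"
    using q \<open>0 < \<eta>\<close> unfolding \<phi>\<eta> by (cases "\<phi> lam x") (auto simp: field_simps)
  have "ereal (l (A *v x) + q / \<eta> + (w - x) \<bullet> (v - x) / \<eta>) \<le> f v" for v
  proof (cases "\<phi> lam v")
    case (real k)
    have "q + (?u - x) \<bullet> (v - x) \<le> \<eta> * k"
      using q_le[of v] by (simp add: \<phi>\<eta> real)
    moreover have "(?u - x) \<bullet> (v - x) = (w - x) \<bullet> (v - x) + \<eta> * (a \<bullet> (A *v v - A *v x))"
    proof -
      have "(transpose A *v a) \<bullet> (v - x) = a \<bullet> (A *v v - A *v x)"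
        by (simp add: dot_lmul_matrix matrix_vector_mult_diff_distrib)
      then show ?thesis
        by (simp add: inner_diff_left inner_add_left del: transpose_matrix_vector)
    qed
    ultimately have "q / \<eta> + (w - x) \<bullet> (v - x) / \<eta> + a \<bullet> (A *v v - A *v x) \<le> k"
      using \<open>0 < \<eta>\<close> by (simp add: field_simps)
    then show ?thesis
      using l_ge[of v] by (simp add: f_def objective_def real)
  qed (use \<phi>(2) in \<open>auto simp: f_def objective_def proper_fun_def\<close>)
  moreover have "f x = ereal (l (A *v x) + q / \<eta>)"
    by (simp add: f_def objective_def x)
  ultimately show thesis
    by (rule that[rotated])
qed

text \<open>For \<alpha> = 2 the contraction factor is \<open>1 / (1 + \<sigma> * \<eta> t)\<close>.
  It tends to 0 if \<eta> is unbounded, which gives superlinear convergence. For a strictly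
  increasing \<eta> it may stay away from 0, so that case asserts convergence with strictly
  decreasing factors.\<close>

theorem theorem3:
  fixes fl :: "real^'m \<Rightarrow> ereal"
    and \<phi> :: "real \<Rightarrow> real^'n \<Rightarrow> ereal"
    and A :: "real^'n^'m"
    and lam \<gamma> \<sigma> \<alpha> :: real
    and \<eta> :: "nat \<Rightarrow> real"
    and w :: "nat \<Rightarrow> real^'n"
    and a :: "nat \<Rightarrow> real^'m"
  defines "f \<equiv> objective fl \<phi> lam A"
  defines "W \<equiv> minimizers f"
  defines "d \<equiv> (\<lambda>t. infdist (w t) W)"
  assumes "lam > 0" and "\<gamma> > 0"
    and "closed_fun fl" and "proper_fun fl" and "strictly_convex_fun fl"
    and "lipschitz_gradient (1 / \<gamma>) fl"
    and "essentially_twice_differentiable (conjugate fl)"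
    and "closed_fun (\<phi> lam)" and "proper_fun (\<phi> lam)" and "convex_fun (\<phi> lam)"
    and "\<And>c x. c > 0 \<Longrightarrow> \<phi> (c * lam) x = ereal c * \<phi> lam x"
    and "W \<noteq> {}"
    and "\<And>t. \<eta> t > 0" and "mono \<eta>"
    and "exact_dal fl \<phi> lam A \<eta> w a"
    and "\<sigma> > 0" and "1 \<le> \<alpha>" and "\<alpha> \<le> 2"
    and "\<And>t. f (w (Suc t)) - (INF v. f v) \<ge> ereal (\<sigma> * d (Suc t) powr \<alpha>)"
  shows "(\<forall>t. d (Suc t) + \<sigma> * \<eta> t * d (Suc t) powr (\<alpha> - 1) \<le> d t) \<and>
    (\<forall>t. d (Suc t) powr ((1 + (\<alpha> - 1) * \<sigma> * \<eta> t) / (1 + \<sigma> * \<eta> t))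
           \<le> 1 / (1 + \<sigma> * \<eta> t) * d t) \<and>
    (\<alpha> < 2 \<longrightarrow> superlinearly_converges_to w W \<and>
       (\<forall>t. (1 + \<sigma> * \<eta> t) / (1 + (\<alpha> - 1) * \<sigma> * \<eta> t) > 1 \<and>
            d (Suc t) \<le> (1 / (1 + \<sigma> * \<eta> t) * d t)
                           powr ((1 + \<sigma> * \<eta> t) / (1 + (\<alpha> - 1) * \<sigma> * \<eta> t)))) \<and>
    (\<alpha> = 2 \<and> filterlim \<eta> at_top sequentially \<longrightarrow> superlinearly_converges_to w W) \<and>
    (\<alpha> = 2 \<and> strict_mono \<eta> \<longrightarrow> d \<longlonglongrightarrow> 0 \<and>
       (\<forall>t. d (Suc t) \<le> 1 / (1 + \<sigma> * \<eta> t) * d t \<and>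
            1 / (1 + \<sigma> * \<eta> (Suc t)) < 1 / (1 + \<sigma> * \<eta> t)))"
proof -
  note \<phi> = \<open>closed_fun (\<phi> lam)\<close> \<open>proper_fun (\<phi> lam)\<close> \<open>convex_fun (\<phi> lam)\<close>
  note pos = \<open>\<And>t. \<eta> t > 0\<close> \<open>\<sigma> > 0\<close>
  obtain G where G: "\<And>z. has_gradient fl (G z) z"
    using \<open>lipschitz_gradient (1 / \<gamma>) fl\<close> unfolding lipschitz_gradient_def by blast
  define l where "l = (\<lambda>z. real_of_ereal (fl z))"
  \<comment> \<open>Having a gradient includes finiteness near the point, so the loss is real valued
    everywhere.\<close>
  have fl: "fl = (\<lambda>z. ereal (l z))"
  proof
    fix z
    have "\<bar>fl z\<bar> \<noteq> \<infinity>"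
      using G[of z] by (auto simp: has_gradient_def dest: eventually_nhds_x_imp_x)
    then show "fl z = ereal (l z)"
      by (simp add: l_def ereal_real)
  qed
  have l': "GDERIV l z :> G z" for z
    using G[of z] by (simp add: has_gradient_def l_def)
  have "convex_on UNIV l"
    using \<open>strictly_convex_fun fl\<close> unfolding fl by (rule strictly_convex_fun_imp_convex_on)
  have "continuous_on UNIV l"
    using l' by (auto simp: gderiv_def intro: has_derivative_continuous continuous_at_imp_continuous_on)
  have W: "closed W" "convex W"
    unfolding W_def f_def fl
    by (intro minimizers_composite_closed_convex \<open>convex_on UNIV l\<close> \<open>continuous_on UNIV l\<close> \<phi>)+
  have d_nonneg: "0 \<le> d t" for t
    by (simp add: d_def infdist_nonneg)
  have step: "d (Suc t) + \<sigma> * \<eta> t * d (Suc t) powr (\<alpha> - 1) \<le> d t" for t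
  proof -
    obtain r where r: "f (w (Suc t)) = ereal r"
      and r_le: "\<And>v. ereal (r + (w t - w (Suc t)) \<bullet> (v - w (Suc t)) / \<eta> t) \<le> f v"
      using exact_dal_step[OF \<open>convex_on UNIV l\<close> l' \<phi>
          \<open>\<And>c x. c > 0 \<Longrightarrow> \<phi> (c * lam) x = ereal c * \<phi> lam x\<close> pos(1)]
        \<open>exact_dal fl \<phi> lam A \<eta> w a\<close> unfolding exact_dal_def f_def fl by metis
    have "\<eta> t * \<sigma> * d (Suc t) powr \<alpha> \<le> (w t - w (Suc t)) \<bullet> (w (Suc t) - v)" if "v \<in> W" for v
    proof -
      have "f v \<le> f v'" for v'
        using that by (simp add: W_def minimizers_def is_arg_min_linorder)
      then have "(INF v. f v) = f v"
        by (intro antisym INF_lower INF_greatest) auto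
      then have growth: "ereal (\<sigma> * d (Suc t) powr \<alpha>) \<le> ereal r - f v"
        using \<open>\<And>t. f (w (Suc t)) - (INF v. f v) \<ge> ereal (\<sigma> * d (Suc t) powr \<alpha>)\<close>[of t] r by simp
      \<comment> \<open>\<open>growth\<close> excludes the value plus infinity and
        \<open>r_le\<close> excludes minus infinity.\<close>
      then obtain k where k: "f v = ereal k"
        using r_le[of v] by (cases "f v") auto
      have "\<sigma> * d (Suc t) powr \<alpha> \<le> - ((w t - w (Suc t)) \<bullet> (v - w (Suc t)) / \<eta> t)"
        using growth r_le[of v] by (simp add: k)
      also have "\<dots> = (w t - w (Suc t)) \<bullet> (w (Suc t) - v) / \<eta> t"
        by (simp add: inner_diff_right diff_divide_distrib)
      finally show ?thesis
        using pos(1)[of t] by (simp add: field_simps)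
    qed
    from infdist_descent[OF W(2,1) \<open>W \<noteq> {}\<close> this] show ?thesis
      using distance_powr_step[OF d_nonneg d_nonneg, of "Suc t" "\<sigma> * \<eta> t" \<alpha> t]
      by (simp add: d_def mult_ac)
  qed
  \<comment> \<open>\<eta> is non-decreasing, so its first value gives one coefficient for all
    steps, as the scalar recursion lemmas require.\<close>
  have step0: "d (Suc t) + \<sigma> * \<eta> 0 * d (Suc t) powr (\<alpha> - 1) \<le> d t" for t
  proof -
    have "\<sigma> * \<eta> 0 * d (Suc t) powr (\<alpha> - 1) \<le> \<sigma> * \<eta> t * d (Suc t) powr (\<alpha> - 1)"
      using pos \<open>mono \<eta>\<close> by (intro mult_right_mono mult_left_mono) (auto simp: monoD)
    with step[of t] show ?thesis by linarith
  qed
  have s: "0 < \<sigma> * \<eta> t" for t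
    using pos by simp
  note rate = powr_rate_step[OF d_nonneg s \<open>1 \<le> \<alpha>\<close> step, unfolded mult.assoc[symmetric]]
  have d0: "d \<longlonglongrightarrow> 0"
    by (rule powr_recursion_tendsto_0[where d = d, OF d_nonneg s \<open>1 \<le> \<alpha>\<close> step0])
  \<comment> \<open>At \<alpha> = 2 the exponent in the rate equals 1.\<close>
  have contraction: "d (Suc t) \<le> 1 / (1 + \<sigma> * \<eta> t) * d t" if "\<alpha> = 2" for t
    using rate(1)[of t] that s[of t] d_nonneg[of "Suc t"] by simp
  have "superlinearly_converges_to w W" if "\<alpha> < 2"
    using d0 powr_recursion_superlinear[where d = d, OF d_nonneg s \<open>1 \<le> \<alpha>\<close> that step0]
    by (simp add: superlinearly_converges_to_def d_def)
  moreover have "(1 + \<sigma> * \<eta> t) / (1 + (\<alpha> - 1) * \<sigma> * \<eta> t) > 1" if "\<alpha> < 2" for t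
  proof -
    have "0 < 1 + (\<alpha> - 1) * (\<sigma> * \<eta> t)"
      using s[of t] \<open>1 \<le> \<alpha>\<close> by (intro add_pos_nonneg) auto
    moreover have "(\<alpha> - 1) * (\<sigma> * \<eta> t) < \<sigma> * \<eta> t"
      using mult_strict_right_mono[of "\<alpha> - 1" 1 "\<sigma> * \<eta> t"] s[of t] that by simp
    ultimately show ?thesis
      by (simp add: mult.assoc)
  qed
  moreover have "superlinearly_converges_to w W"
    if "\<alpha> = 2" and "filterlim \<eta> at_top sequentially"
  proof -
    have "\<forall>\<^sub>F t in sequentially. d (Suc t) \<le> e * d t" if "0 < e" for e
    proof -
      \<comment> \<open>Beyond this threshold \<open>\<sigma> * \<eta> t\<close> is at least
        \<open>1 / e\<close>, so the contraction factor is at most \<open>e\<close>.\<close>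
      have "\<forall>\<^sub>F t in sequentially. 1 / (e * \<sigma>) \<le> \<eta> t"
        using \<open>filterlim \<eta> at_top sequentially\<close> by (simp add: filterlim_at_top)
      then show ?thesis
      proof eventually_elim
        case (elim t)
        have "1 / (1 + \<sigma> * \<eta> t) \<le> e"
          using elim \<open>0 < e\<close> pos(2) s[of t] by (simp add: field_simps)
        then have "1 / (1 + \<sigma> * \<eta> t) * d t \<le> e * d t"
          by (intro mult_right_mono d_nonneg)
        with contraction[OF \<open>\<alpha> = 2\<close>, of t] show ?case by linarith
      qed
    qed
    then show ?thesis
      using d0 by (simp add: superlinearly_converges_to_def d_def)
  qed
  moreover have "1 / (1 + \<sigma> * \<eta> (Suc t)) < 1 / (1 + \<sigma> * \<eta> t)" if "strict_mono \<eta>" for t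
  proof -
    have "\<eta> t < \<eta> (Suc t)"
      using that by (simp add: strict_mono_Suc_iff)
    then show ?thesis
      using pos(2) s[of t] by (intro divide_strict_left_mono) (auto intro!: mult_pos_pos add_pos_pos s)
  qed
  ultimately show ?thesis
    using step rate d0 contraction by blast
qed

end
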